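(* Fix $\mathcal{X}=\{0,1\}^d$, $\mathcal{Y}=\{0,1\}$, and $K=2$ groups (encoded by the last bit of $x$). Then the cost of coupling, $\text{cost-of-coupling}(\mathcal{C},\ell)$, is at least $1/4$ for: 1. Linear regression: $\mathcal{Z}=\mathbb{R}$, $\mathcal{C}=\{x\mapsto w\cdot x+b \mid w\in\mathbb{R}^d, b\in\mathbb{R}\}$, and $\ell(y,z)=(y-z)^2$. 2. Linear separators: $\mathcal{Z}=\{0,1\}$, $\mathcal{C}=\{x\mapsto \mathbb{I}[w\cdot x+b\ge 0] \mid w\in\mathbb{R}^d, b\in\mathbb{R}\}$, and $\ell(y,z)=|y-z|$. 3. Bounded-size decision trees: $\mathcal{Z}=\{0,1\}$, $\mathcal{C}$ is the set of binary decision trees of size at most $2^s$ leaves, and $\ell(y,z)=|y-z|$.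
   Context: The set of examples is partitioned by group, $\mathcal{X}=\mathcal{X}_1\cup\dots\cup\mathcal{X}_K$, and $g(x)\in\{1,\dots,K\}$ denotes the index of the group containing $x$; here the group is determined by the last bit $x_d$. $\mathcal{Y}$ is the set of labels and $\mathcal{Z}$ the set of classifications. A classifier is a function $c:\mathcal{X}\to\mathcal{Z}$, and $\mathcal{C}$ is a family of classifiers. For a loss function $\ell:\mathcal{Y}\times\mathcal{Z}\to\mathbb{R}$ and a probability distribution $\mathcal{D}$ on $\mathcal{X}\times\mathcal{Y}$, let $\ell_{\mathcal{D}}(c)=\mathrm{E}_{(x,y)\sim\mathcal{D}}[\ell(y,c(x))]$. For $\vec{c}=(c_1,\dots,c_K)\in\mathcal{C}^K$, the decoupled classifier $\gamma_{\vec c}:\mathcal{X}\to\mathcal{Z}$ is $\gamma_{\vec c}(x)=c_{g(x)}(x)$, and $\gamma(\mathcal{C})=\{\gamma_{\vec c} \mid \vec c\in\mathcal{C}^K\}$. The cost of coupling is $$\text{cost-of-coupling}(\mathcal{C},\ell)=\max_{\mathcal{D}\in\Delta(\mathcal{X}\times\mathcal{Y})}\Bigl[\min_{c\in\mathcal{C}}\ell_{\mathcal{D}}(c)-\min_{\gamma_{\vec c}\in\gamma(\mathcal{C})}\ell_{\mathcal{D}}(\gamma_{\vec c})\Bigr],$$ where $\Delta(S)$ is the set of probability distributions on $S$. To avoid measure-theoretic issues, $\mathcal{C},\mathcal{X},\mathcal{Y}$ are required to be finite sets; real parameters are thought of as represented with fixed precision (a bounded number of bits), so that these sets may be assumed finite,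 though possibly exponentially large. $\mathbb{I}[\phi]$ equals $1$ if $\phi$ is true and $0$ otherwise, and $w\cdot x$ is the inner product. A binary decision tree is a rooted binary tree whose internal nodes each query one bit of the input (branching according to its value) and whose leaves are labelled by elements of $\{0,1\}$; it computes the label of the leaf reached.
   Formalization: Parts 1 and 2 are stated for d ≥ 2 and part 3 for s < d: when d = 1 (parts 1, 2) or s ≥ d (part 3) the class contains every function needed, so the cost of coupling is 0 and the claim fails. Max and min are read as supremum and infimum. *)

theory Defs
  imports "HOL-Probability.Probability"
begin

section \<open>Decoupled classifiers and the cost of coupling\<close>

definition expected_loss :: "('y \<Rightarrow> 'z \<Rightarrow> real) \<Rightarrow> ('x \<times> 'y) pmf \<Rightarrow> ('x \<Rightarrow> 'z) \<Rightarrow> real" where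
  "expected_loss l D c = measure_pmf.expectation D (\<lambda>(x, y). l y (c x))"

definition decoupled :: "('x \<Rightarrow> nat) \<Rightarrow> (nat \<Rightarrow> 'x \<Rightarrow> 'z) \<Rightarrow> 'x \<Rightarrow> 'z" where
  "decoupled g cs = (\<lambda>x. cs (g x) x)"

definition decoupled_class ::
    "nat \<Rightarrow> ('x \<Rightarrow> nat) \<Rightarrow> ('x \<Rightarrow> 'z) set \<Rightarrow> ('x \<Rightarrow> 'z) set" where
  "decoupled_class K g C = {decoupled g cs | cs. \<forall>k\<in>{1..K}. cs k \<in> C}"

text \<open>
  The extrema are written as infimum and supremum, since a class with real parameters is
  infinite; they agree with minimum and maximum whenever those are attained.
  The operators are those of the conditionally complete type \<^typ>\<open>real\<close> and so are
  meaningful only on nonempty bounded sets.  This is the case for all classes and losses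
  below: losses are nonnegative, every class contains the constant classifier \<open>0\<close>,
  and that classifier has expected loss at most \<open>1\<close>.
  Classifiers are total functions on \<open>'x\<close>, but their values outside \<open>X\<close> are irrelevant
  because \<open>D\<close> ranges over distributions supported in \<open>X \<times> Y\<close>.
\<close>

definition cost_of_coupling ::
    "'x set \<Rightarrow> 'y set \<Rightarrow> nat \<Rightarrow> ('x \<Rightarrow> nat) \<Rightarrow> ('x \<Rightarrow> 'z) set \<Rightarrow> ('y \<Rightarrow> 'z \<Rightarrow> real) \<Rightarrow> real" where
  "cost_of_coupling X Y K g C l =
     (SUP D \<in> {D. set_pmf D \<subseteq> X \<times> Y}.
        (INF c \<in> C. expected_loss l D c) - (INF c \<in> decoupled_class K g C. expected_loss l D c))"

section \<open>The Boolean cube, grouped by the last bit\<close>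

text \<open>Points of \<open>{0,1}\<^sup>d\<close> have coordinates \<open>x 1, \<dots>, x d\<close>; the groups are numbered 1 and 2.\<close>

definition cube :: "nat \<Rightarrow> (nat \<Rightarrow> nat) set" where
  "cube d = {1..d} \<rightarrow>\<^sub>E {0, 1}"

definition last_bit_group :: "nat \<Rightarrow> (nat \<Rightarrow> nat) \<Rightarrow> nat" where
  "last_bit_group d x = x d + 1"

definition dot :: "nat \<Rightarrow> (nat \<Rightarrow> real) \<Rightarrow> (nat \<Rightarrow> nat) \<Rightarrow> real" where
  "dot d w x = (\<Sum>i=1..d. w i * real (x i))"

section \<open>Classifier families and losses\<close>

definition linear_regressors :: "nat \<Rightarrow> ((nat \<Rightarrow> nat) \<Rightarrow> real) set" where
  "linear_regressors d = {\<lambda>x. dot d w x + b | w b. True}"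

definition linear_separators :: "nat \<Rightarrow> ((nat \<Rightarrow> nat) \<Rightarrow> nat) set" where
  "linear_separators d = {\<lambda>x. of_bool (dot d w x + b \<ge> 0) | w b. True}"

datatype (queries: 'i, labels: 'l) decision_tree =
  Leaf 'l
| Node 'i "('i, 'l) decision_tree" "('i, 'l) decision_tree"

fun tree_eval :: "('i, 'l) decision_tree \<Rightarrow> ('i \<Rightarrow> nat) \<Rightarrow> 'l" where
  "tree_eval (Leaf a) x = a"
| "tree_eval (Node i t0 t1) x = (if x i = 0 then tree_eval t0 x else tree_eval t1 x)"

fun num_leaves :: "('i, 'l) decision_tree \<Rightarrow> nat" where
  "num_leaves (Leaf a) = 1"
| "num_leaves (Node i t0 t1) = num_leaves t0 + num_leaves t1"

definition decision_tree_classifiers :: "nat \<Rightarrow> nat \<Rightarrow> ((nat \<Rightarrow> nat) \<Rightarrow> nat) set" where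
  "decision_tree_classifiers d m =
     {tree_eval t | t. queries t \<subseteq> {1..d} \<and> labels t \<subseteq> {0, 1} \<and> num_leaves t \<le> m}"

definition squared_loss :: "nat \<Rightarrow> real \<Rightarrow> real" where
  "squared_loss y z = (real y - z)\<^sup>2"

definition absolute_loss :: "nat \<Rightarrow> nat \<Rightarrow> real" where
  "absolute_loss y z = \<bar>real y - real z\<bar>"

end

theory Submission
  imports Defs
begin

text \<open>
  All three lower bounds come from parity.  For a set \<open>T\<close> of coordinates containing the last one,
  draw a uniformly random subset \<open>A\<close> of \<open>T\<close>, let \<open>x\<close> be its indicator vector and
  \<open>y\<close> the parity of \<open>A\<close>.  Within one group the last bit is constant, so only the parity of
  the remaining bits of \<open>T\<close> has to be computed, and the decoupled classifier makes no error.
  For the linear classes, \<open>T\<close> has two elements and the problem is XOR, on which affine functions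
  have squared loss at least \<open>1/4\<close> and half-spaces misclassify one of four points.
  For trees, \<open>T\<close> has \<open>s + 1\<close> elements: a leaf is correlated with parity only if all of \<open>T\<close>
  has been queried on its path, so each leaf contributes at most 1 to the sum of
  \<open>(-1)^y (-1)^c(x)\<close> over \<open>2^(s+1)\<close> points, and \<open>2^s\<close> leaves give error at least \<open>1/4\<close>.
\<close>

section \<open>Lower bounds on the cost of coupling\<close>

text \<open>On \<open>real\<close>, \<open>SUP\<close> and \<open>INF\<close> can be compared with
  single values only on bounded sets. Nonnegative losses bound both infima from below, and
  \<open>c0\<close>, whose expected loss is at most \<open>M\<close> for every admissible
  distribution, bounds the gap from above. The supremum then dominates the gap at the one
  distribution \<open>D\<close>.\<close>

lemma cost_of_coupling_ge:
  fixes l :: "'y \<Rightarrow> 'z \<Rightarrow> real"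
  assumes nonneg: "\<And>y z. 0 \<le> l y z"
    and c0: "c0 \<in> C" and bound: "\<And>x y. x \<in> X \<Longrightarrow> y \<in> Y \<Longrightarrow> l y (c0 x) \<le> M"
    and D: "set_pmf D \<subseteq> X \<times> Y"
    and coupled: "\<And>c. c \<in> C \<Longrightarrow> a \<le> expected_loss l D c"
    and c1: "c1 \<in> decoupled_class K g C" "expected_loss l D c1 \<le> e"
  shows "a - e \<le> cost_of_coupling X Y K g C l"
proof -
  have nn: "0 \<le> expected_loss l D' c" for D' c
    unfolding expected_loss_def by (rule Bochner_Integration.integral_nonneg) (auto simp: nonneg)
  have bdd: "bdd_below ((\<lambda>c. expected_loss l D' c) ` S)" for D' S
    by (rule bdd_belowI[of _ 0]) (auto simp: nn)
  have le: "expected_loss l D' c0 \<le> M" if D': "set_pmf D' \<subseteq> X \<times> Y" for D'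
  proof -
    have AE: "AE z in measure_pmf D'. (\<lambda>(x, y). l y (c0 x)) z \<le> M"
      using D' bound by (auto simp: AE_measure_pmf_iff)
    moreover have "integrable (measure_pmf D') (\<lambda>(x, y). l y (c0 x))"
      by (rule measure_pmf.integrable_const_bound[where B = M])
         (use AE nonneg in \<open>auto simp: case_prod_unfold\<close>)
    ultimately show ?thesis
      unfolding expected_loss_def by (intro measure_pmf.integral_le_const)
  qed
  have "bdd_above ((\<lambda>D. (INF c \<in> C. expected_loss l D c)
      - (INF c \<in> decoupled_class K g C. expected_loss l D c)) ` {D. set_pmf D \<subseteq> X \<times> Y})"
  proof (rule bdd_aboveI2[of _ _ M])
    fix D' :: "('a \<times> 'y) pmf" assume "D' \<in> {D. set_pmf D \<subseteq> X \<times> Y}"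
    then have "(INF c \<in> C. expected_loss l D' c) \<le> M"
      using cINF_lower[OF bdd c0, of D'] le[of D'] by simp
    moreover have "0 \<le> (INF c \<in> decoupled_class K g C. expected_loss l D' c)"
      using c1(1) nn by (intro cINF_greatest) auto
    ultimately show "(INF c \<in> C. expected_loss l D' c)
        - (INF c \<in> decoupled_class K g C. expected_loss l D' c) \<le> M" by simp
  qed
  then have "(INF c \<in> C. expected_loss l D c) - (INF c \<in> decoupled_class K g C. expected_loss l D c)
      \<le> cost_of_coupling X Y K g C l"
    unfolding cost_of_coupling_def using D by (intro cSUP_upper) auto
  moreover have "a \<le> (INF c \<in> C. expected_loss l D c)"
    using c0 coupled by (intro cINF_greatest) auto
  moreover have "(INF c \<in> decoupled_class K g C. expected_loss l D c) \<le> e"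
    using cINF_lower[OF bdd c1(1), of D] c1(2) by simp
  ultimately show ?thesis by linarith
qed

lemma decoupled_class_last_bitI:
  assumes "f0 \<in> C" "f1 \<in> C"
  shows "(\<lambda>x. if x d = 0 then f0 x else f1 x) \<in> decoupled_class 2 (last_bit_group d) C"
proof -
  \<comment> \<open>Every index other than 1 gets \<open>f1\<close>, so the equation also holds at
    points outside the cube, where \<open>x d\<close> may exceed 1.\<close>
  have "(\<lambda>x. if x d = 0 then f0 x else f1 x)
      = decoupled (last_bit_group d) (\<lambda>k. if k = 1 then f0 else f1)"
    by (auto simp: decoupled_def last_bit_group_def)
  then show ?thesis
    unfolding decoupled_class_def using assms by auto
qed

section \<open>The parity distribution\<close>

text \<open>The restriction to \<open>{1..d}\<close> makes the point extensional, as membership in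
  \<open>cube d\<close> demands.\<close>

definition indicator_point :: "nat \<Rightarrow> nat set \<Rightarrow> nat \<Rightarrow> nat" where
  "indicator_point d A = (\<lambda>i\<in>{1..d}. of_bool (i \<in> A))"

definition parity_pmf :: "nat \<Rightarrow> nat set \<Rightarrow> ((nat \<Rightarrow> nat) \<times> nat) pmf" where
  "parity_pmf d T = map_pmf (\<lambda>A. (indicator_point d A, card A mod 2)) (pmf_of_set (Pow T))"

lemma indicator_point_apply: "i \<in> {1..d} \<Longrightarrow> indicator_point d A i = of_bool (i \<in> A)"
  by (simp add: indicator_point_def)

lemma set_parity_pmf:
  assumes "finite T"
  shows "set_pmf (parity_pmf d T) \<subseteq> cube d \<times> {0, 1}"
  using assms by (auto simp: parity_pmf_def set_pmf_of_set cube_def indicator_point_def Pow_not_empty)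

lemma expected_loss_parity_pmf:
  assumes "finite T"
  shows "expected_loss l (parity_pmf d T) c
    = (\<Sum>A\<in>Pow T. l (card A mod 2) (c (indicator_point d A))) / 2 ^ card T"
  using assms
  by (simp add: expected_loss_def parity_pmf_def integral_pmf_of_set Pow_not_empty card_Pow)

text \<open>Unlike above, \<open>T\<close> omits the last bit, which the grouping already exposes.\<close>

lemma cost_of_coupling_parity:
  fixes C :: "((nat \<Rightarrow> nat) \<Rightarrow> 'z) set"
  assumes d: "1 \<le> d" and T: "finite T" "d \<notin> T"
    and nonneg: "\<And>y z. 0 \<le> l y z"
    and c0: "c0 \<in> C" "\<And>x y. y \<in> {0, 1} \<Longrightarrow> l y (c0 x) \<le> M"
    and coupled: "\<And>c. c \<in> C \<Longrightarrow>
      a * 2 ^ Suc (card T) \<le> (\<Sum>A\<in>Pow (insert d T). l (card A mod 2) (c (indicator_point d A)))"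
    and f0: "f0 \<in> C" "\<And>A. A \<subseteq> T \<Longrightarrow> l (card A mod 2) (f0 (indicator_point d A)) = 0"
    and f1: "f1 \<in> C"
      "\<And>A. A \<subseteq> T \<Longrightarrow> l (Suc (card A) mod 2) (f1 (indicator_point d (insert d A))) = 0"
  shows "a \<le> cost_of_coupling (cube d) {0, 1} 2 (last_bit_group d) C l"
proof -
  define c1 where "c1 = (\<lambda>x::nat \<Rightarrow> nat. if x d = 0 then f0 x else f1 x)"
  have "l (card A mod 2) (c1 (indicator_point d A)) = 0" if A: "A \<subseteq> insert d T" for A
  proof (cases "d \<in> A")
    case True
    have "finite A" using A T(1) by (meson finite.insertI finite_subset)
    \<comment> \<open>The last bit contributes one to the count, so in this group \<open>f1\<close>
      has to match the flipped parity of \<open>A - {d}\<close>.\<close>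
    then have "card A = Suc (card (A - {d}))" using True by (rule card.remove)
    moreover have "insert d (A - {d}) = A" using True by auto
    ultimately show ?thesis
      using f1(2)[of "A - {d}"] A True d by (auto simp: c1_def indicator_point_apply)
  next
    case False
    then show ?thesis using f0(2)[of A] A d by (auto simp: c1_def indicator_point_apply)
  qed
  then have 1: "expected_loss l (parity_pmf d (insert d T)) c1 \<le> 0"
    using T by (simp add: expected_loss_parity_pmf)
  \<comment> \<open>The factor \<open>2 ^ Suc (card T)\<close> is the number of equally likely
    points, one for each subset of \<open>insert d T\<close>.\<close>
  have 2: "a \<le> expected_loss l (parity_pmf d (insert d T)) c" if "c \<in> C" for c
    using coupled[OF that] T by (simp add: expected_loss_parity_pmf pos_le_divide_eq)
  have "a - 0 \<le> cost_of_coupling (cube d) {0, 1} 2 (last_bit_group d) C l"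
  proof (rule cost_of_coupling_ge[OF nonneg c0(1) c0(2) set_parity_pmf 2 _ 1])
    show "c1 \<in> decoupled_class 2 (last_bit_group d) C"
      unfolding c1_def using f0(1) f1(1) by (rule decoupled_class_last_bitI)
  qed (use T in auto)
  then show ?thesis by simp
qed

section \<open>Linear classifiers\<close>

lemma dot_indicator_point:
  assumes "A \<subseteq> {1..d}"
  shows "dot d w (indicator_point d A) = sum w A"
proof -
  have "dot d w (indicator_point d A) = (\<Sum>i=1..d. if i \<in> A then w i else 0)"
    unfolding dot_def by (intro sum.cong) (auto simp: indicator_point_apply)
  also have "\<dots> = sum w A"
    using assms by (simp add: sum.inter_restrict[symmetric] Int_absorb1)
  finally show ?thesis .
qed

lemma sum_Pow_doubleton:
  fixes f :: "'a set \<Rightarrow> 'b::comm_monoid_add"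
  assumes "i \<noteq> j"
  shows "sum f (Pow {i, j}) = f {} + f {i} + f {j} + f {i, j}"
proof -
  have "Pow {i, j} = {{}, {i}, {j}, {i, j}}" by auto
  then show ?thesis using assms by (simp add: doubleton_eq_iff add.assoc)
qed

text \<open>The weight vector is \<open>r\<close> times the first unit vector; it serves for the
  explicit classifiers that look at bit 1 alone.\<close>

lemma dot_unit:
  assumes "1 \<le> d"
  shows "dot d (\<lambda>i. of_bool (i = 1) * r) x = r * real (x 1)"
proof -
  have "dot d (\<lambda>i. of_bool (i = 1) * r) x = (\<Sum>i=1..d. if i = 1 then r * real (x 1) else 0)"
    unfolding dot_def by (intro sum.cong) auto
  then show ?thesis using assms by simp
qed

text \<open>The four terms are the squared residuals of an affine function with intercept
  \<open>b\<close> and weights \<open>u\<close>, \<open>v\<close> on the four points of XOR.\<close>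

lemma xor_squared_loss:
  fixes b u v :: real
  shows "1 \<le> b\<^sup>2 + (1 - (u + b))\<^sup>2 + (1 - (v + b))\<^sup>2 + (- u - v - b)\<^sup>2"
proof -
  \<comment> \<open>The best fit is the constant 1/2. As the values at opposite corners have equal
    sums, the difference of the two sides of the claim is exactly this sum of squares.\<close>
  have "0 \<le> (b - 1/2)\<^sup>2 + (u + b - 1/2)\<^sup>2 + (v + b - 1/2)\<^sup>2 + (u + v + b - 1/2)\<^sup>2"
    by simp
  then show ?thesis by (simp add: power2_eq_square algebra_simps)
qed

lemma cost_of_coupling_linear_regressors:
  assumes d: "2 \<le> d"
  shows "1 / 4 \<le> cost_of_coupling (cube d) {0, 1} 2 (last_bit_group d)
    (linear_regressors d) squared_loss"
proof (rule cost_of_coupling_parity[where T = "{1}" and M = 1 and ?c0.0 = "\<lambda>x. 0"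
      and ?f0.0 = "\<lambda>x. real (x 1)" and ?f1.0 = "\<lambda>x. 1 - real (x 1)"])
  show "(\<lambda>x. 0) \<in> linear_regressors d"
    unfolding linear_regressors_def
    by (intro CollectI exI[of _ "\<lambda>_. 0"] exI[of _ 0]) (simp add: dot_def)
  show "(\<lambda>x. real (x 1)) \<in> linear_regressors d"
    unfolding linear_regressors_def using d
    by (intro CollectI exI[of _ "\<lambda>i. of_bool (i = 1) * 1"] exI[of _ 0]) (simp only: dot_unit, simp)
  show "(\<lambda>x. 1 - real (x 1)) \<in> linear_regressors d"
    unfolding linear_regressors_def using d
    by (intro CollectI exI[of _ "\<lambda>i. of_bool (i = 1) * - 1"] exI[of _ 1]) (subst dot_unit, auto)
next
  fix c :: "(nat \<Rightarrow> nat) \<Rightarrow> real" assume "c \<in> linear_regressors d"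
  then obtain w b where c: "c = (\<lambda>x. dot d w x + b)" by (auto simp: linear_regressors_def)
  show "1 / 4 * 2 ^ Suc (card {1::nat})
      \<le> (\<Sum>A\<in>Pow (insert d {1}). squared_loss (card A mod 2) (c (indicator_point d A)))"
    using d xor_squared_loss[of b "w d" "w 1"]
    by (simp add: sum_Pow_doubleton c dot_indicator_point squared_loss_def)
qed (use d in \<open>auto simp: squared_loss_def indicator_point_apply subset_singleton_iff\<close>)

lemma cost_of_coupling_linear_separators:
  assumes d: "2 \<le> d"
  shows "1 / 4 \<le> cost_of_coupling (cube d) {0, 1} 2 (last_bit_group d)
    (linear_separators d) absolute_loss"
proof (rule cost_of_coupling_parity[where T = "{1}" and M = 1 and ?c0.0 = "\<lambda>x. 0"
      and ?f0.0 = "\<lambda>x. of_bool (1 \<le> x 1)" and ?f1.0 = "\<lambda>x. of_bool (x 1 \<le> 0)"])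
  \<comment> \<open>The threshold accepts 0, so the constant 0 needs a negative intercept.\<close>
  show "(\<lambda>x. 0) \<in> linear_separators d"
    unfolding linear_separators_def
    by (intro CollectI exI[of _ "\<lambda>_. 0"] exI[of _ "-1"]) (simp add: dot_def)
  show "(\<lambda>x. of_bool (1 \<le> x 1)) \<in> linear_separators d"
    unfolding linear_separators_def using d
    by (intro CollectI exI[of _ "\<lambda>i. of_bool (i = 1) * 1"] exI[of _ "-1"]) (subst dot_unit, auto)
  show "(\<lambda>x. of_bool (x 1 \<le> 0)) \<in> linear_separators d"
    unfolding linear_separators_def using d
    by (intro CollectI exI[of _ "\<lambda>i. of_bool (i = 1) * - 1"] exI[of _ 0]) (subst dot_unit, auto)
next
  fix c :: "(nat \<Rightarrow> nat) \<Rightarrow> nat" assume "c \<in> linear_separators d"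
  then obtain w b where c: "c = (\<lambda>x. of_bool (dot d w x + b \<ge> 0))"
    by (auto simp: linear_separators_def)
  show "1 / 4 * 2 ^ Suc (card {1::nat})
      \<le> (\<Sum>A\<in>Pow (insert d {1}). absolute_loss (card A mod 2) (c (indicator_point d A)))"
    \<comment> \<open>Without any error, \<open>b < 0\<close> while \<open>w 1 + b\<close> and
      \<open>w d + b\<close> are nonnegative; their sum exceeds \<open>w 1 + w d + b < 0\<close> by
      \<open>b\<close>, which is impossible. So at least one of the four points is
      misclassified.\<close>
    using d by (simp add: sum_Pow_doubleton c dot_indicator_point absolute_loss_def of_bool_def)
qed (use d in \<open>auto simp: absolute_loss_def indicator_point_apply subset_singleton_iff\<close>)

section \<open>Decision trees\<close>

text \<open>If \<open>B\<close> is a proper subset of \<open>T\<close>, toggling one element of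
  \<open>T - B\<close> pairs even sets with odd ones and the sum cancels. Otherwise the interval has
  at most one member.\<close>

lemma abs_sum_parity_interval_le_1:
  assumes "finite T"
  shows "\<bar>\<Sum>A | B \<subseteq> A \<and> A \<subseteq> T. (-1) ^ card A\<bar> \<le> (1::real)"
proof (cases "B \<subset> T")
  case True
  have "finite {A. B \<subseteq> A \<and> A \<subseteq> T}"
    using assms by (auto intro: finite_subset[of _ "Pow T"])
  then have "(\<Sum>A | B \<subseteq> A \<and> A \<subseteq> T. (-1) ^ card A) = (0::real)"
    using card_subsupersets_even_odd[OF assms True]
    by (intro sum_alternating_cancels) (simp_all add: conj_ac)
  then show ?thesis by simp
next
  case False
  then have "{A. B \<subseteq> A \<and> A \<subseteq> T} = (if B = T then {T} else {})" by auto
  then show ?thesis by simp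
qed

text \<open>The interval from \<open>B\<close> to \<open>T\<close> describes the inputs reaching a
  node: an answer 1 at \<open>i\<close> adds \<open>i\<close> to \<open>B\<close>, an answer 0
  removes it from \<open>T\<close>. Induction over all \<open>B\<close> and \<open>T\<close> thus
  adds up the contributions of the leaves; a query with a forced answer leaves one branch an empty
  interval.\<close>

lemma tree_parity_correlation:
  fixes h :: "'l \<Rightarrow> real"
  assumes "finite T" and "\<And>a. a \<in> labels t \<Longrightarrow> \<bar>h a\<bar> \<le> 1"
    and "\<And>A i. i \<in> queries t \<Longrightarrow> p A i = of_bool (i \<in> A)"
  shows "\<bar>\<Sum>A | B \<subseteq> A \<and> A \<subseteq> T. (-1) ^ card A * h (tree_eval t (p A))\<bar> \<le> real (num_leaves t)"
  using assms
proof (induction t arbitrary: B T)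
  case (Leaf a)
  have "\<bar>\<Sum>A | B \<subseteq> A \<and> A \<subseteq> T. (-1) ^ card A\<bar> * \<bar>h a\<bar> \<le> 1 * 1"
    using abs_sum_parity_interval_le_1[OF Leaf.prems(1)] Leaf.prems(2) by (intro mult_mono) auto
  then show ?case by (simp add: sum_distrib_right[symmetric] abs_mult)
next
  case (Node i t0 t1)
  let ?F = "\<lambda>t A. (-1) ^ card A * h (tree_eval t (p A))"
  have split: "{A. B \<subseteq> A \<and> A \<subseteq> T}
      = {A. B \<subseteq> A \<and> A \<subseteq> T - {i}} \<union> {A. insert i B \<subseteq> A \<and> A \<subseteq> T}"
    by auto
  have fin: "finite {A. S \<subseteq> A \<and> A \<subseteq> T'}" if "T' \<subseteq> T" for S T'
    using Node.prems(1) that by (auto intro: finite_subset[of _ "Pow T"])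
  have "(\<Sum>A | B \<subseteq> A \<and> A \<subseteq> T. ?F (Node i t0 t1) A)
      = (\<Sum>A | B \<subseteq> A \<and> A \<subseteq> T - {i}. ?F (Node i t0 t1) A)
        + (\<Sum>A | insert i B \<subseteq> A \<and> A \<subseteq> T. ?F (Node i t0 t1) A)"
    unfolding split using fin by (intro sum.union_disjoint) auto
  also have "(\<Sum>A | B \<subseteq> A \<and> A \<subseteq> T - {i}. ?F (Node i t0 t1) A)
      = (\<Sum>A | B \<subseteq> A \<and> A \<subseteq> T - {i}. ?F t0 A)"
    using Node.prems(3)[of i] by (intro sum.cong) auto
  also have "(\<Sum>A | insert i B \<subseteq> A \<and> A \<subseteq> T. ?F (Node i t0 t1) A)
      = (\<Sum>A | insert i B \<subseteq> A \<and> A \<subseteq> T. ?F t1 A)"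
    using Node.prems(3)[of i] by (intro sum.cong) auto
  finally have "(\<Sum>A | B \<subseteq> A \<and> A \<subseteq> T. ?F (Node i t0 t1) A)
      = (\<Sum>A | B \<subseteq> A \<and> A \<subseteq> T - {i}. ?F t0 A)
        + (\<Sum>A | insert i B \<subseteq> A \<and> A \<subseteq> T. ?F t1 A)" .
  moreover have "\<bar>\<Sum>A | B \<subseteq> A \<and> A \<subseteq> T - {i}. ?F t0 A\<bar> \<le> real (num_leaves t0)"
    using Node.prems by (intro Node.IH) auto
  moreover have "\<bar>\<Sum>A | insert i B \<subseteq> A \<and> A \<subseteq> T. ?F t1 A\<bar> \<le> real (num_leaves t1)"
    using Node.prems by (intro Node.IH) auto
  ultimately show ?case by simp
qed

lemma tree_parity_error:
  assumes "finite T" and labels: "labels t \<subseteq> {0, 1}" and "queries t \<subseteq> {1..d}"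
  shows "2 ^ card T - real (num_leaves t)
    \<le> 2 * (\<Sum>A\<in>Pow T. absolute_loss (card A mod 2) (tree_eval t (indicator_point d A)))"
proof -
  have eval: "tree_eval t x \<in> labels t" for x :: "nat \<Rightarrow> nat"
    by (induction t) auto
  \<comment> \<open>For bits, \<open>2 * |y - z| = 1 - (-1)^y * (-1)^z\<close>, and
    \<open>(-1)^z = 1 - 2 * z\<close>. This turns the error count into a correlation with
    parity.\<close>
  have "2 * absolute_loss (card A mod 2) (tree_eval t (indicator_point d A))
      = 1 - (-1) ^ card A * (1 - 2 * real (tree_eval t (indicator_point d A)))" for A
  proof -
    have "tree_eval t (indicator_point d A) \<in> {0, 1}"
      using eval labels by blast
    then show ?thesis
      by (cases "even (card A)") (auto simp: absolute_loss_def odd_iff_mod_2_eq_one)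
  qed
  then have "2 * (\<Sum>A\<in>Pow T. absolute_loss (card A mod 2) (tree_eval t (indicator_point d A)))
      = 2 ^ card T
        - (\<Sum>A\<in>Pow T. (-1) ^ card A * (1 - 2 * real (tree_eval t (indicator_point d A))))"
    using assms(1) by (simp add: sum_distrib_left sum_subtractf card_Pow)
  moreover have "\<bar>\<Sum>A | {} \<subseteq> A \<and> A \<subseteq> T.
      (-1) ^ card A * (1 - 2 * real (tree_eval t (indicator_point d A)))\<bar> \<le> real (num_leaves t)"
    using assms by (intro tree_parity_correlation) (auto simp: indicator_point_apply)
  ultimately show ?thesis by (simp add: Pow_def)
qed

text \<open>The parameter \<open>k\<close> carries the number of ones already counted; starting it
  at 1 instead of 0 complements the parity.\<close>

fun parity_tree :: "nat \<Rightarrow> nat \<Rightarrow> (nat, nat) decision_tree" where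
  "parity_tree 0 k = Leaf (k mod 2)"
| "parity_tree (Suc n) k = Node (Suc n) (parity_tree n k) (parity_tree n (Suc k))"

lemma parity_tree_classifier:
  assumes "n \<le> d"
  shows "tree_eval (parity_tree n k) \<in> decision_tree_classifiers d (2 ^ n)"
proof -
  have "queries (parity_tree n k) \<subseteq> {1..n}"
    by (induction n arbitrary: k) force+
  moreover have "labels (parity_tree n k) \<subseteq> {0, 1}"
    by (induction n arbitrary: k) auto
  moreover have "num_leaves (parity_tree n k) = 2 ^ n"
    by (induction n arbitrary: k) auto
  ultimately show ?thesis
    using assms unfolding decision_tree_classifiers_def by fastforce
qed

lemma tree_eval_parity_tree:
  assumes "n \<le> d"
  shows "tree_eval (parity_tree n k) (indicator_point d A) = (card (A \<inter> {1..n}) + k) mod 2"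
  using assms
proof (induction n arbitrary: k)
  case (Suc n)
  have "A \<inter> {1..Suc n} = (if Suc n \<in> A then insert (Suc n) (A \<inter> {1..n}) else A \<inter> {1..n})"
    by (auto simp: le_Suc_eq)
  then show ?case using Suc by (simp add: indicator_point_apply)
qed simp

lemma cost_of_coupling_decision_trees:
  assumes s: "s < d"
  shows "1 / 4 \<le> cost_of_coupling (cube d) {0, 1} 2 (last_bit_group d)
    (decision_tree_classifiers d (2 ^ s)) absolute_loss"
\<comment> \<open>Full trees on the first \<open>s\<close> bits exhaust the budget of
  \<open>2 ^ s\<close> leaves. The start value 1 in the second tree accounts for the last
  bit.\<close>
proof (rule cost_of_coupling_parity[where T = "{1..s}" and M = 1 and ?c0.0 = "\<lambda>x. 0"
      and ?f0.0 = "tree_eval (parity_tree s 0)" and ?f1.0 = "tree_eval (parity_tree s 1)"])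
  show "(\<lambda>x. 0) \<in> decision_tree_classifiers d (2 ^ s)"
    unfolding decision_tree_classifiers_def by (intro CollectI exI[of _ "Leaf 0"]) auto
  show "tree_eval (parity_tree s 0) \<in> decision_tree_classifiers d (2 ^ s)"
    "tree_eval (parity_tree s 1) \<in> decision_tree_classifiers d (2 ^ s)"
    using s by (simp_all add: parity_tree_classifier)
next
  fix A assume A: "A \<subseteq> {1..s}"
  then have "insert d A \<inter> {1..s} = A" "A \<inter> {1..s} = A" using s by auto
  then show "absolute_loss (card A mod 2) (tree_eval (parity_tree s 0) (indicator_point d A)) = 0"
    "absolute_loss (Suc (card A) mod 2)
      (tree_eval (parity_tree s 1) (indicator_point d (insert d A))) = 0"
    using s by (simp_all add: tree_eval_parity_tree absolute_loss_def)
next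
  fix c :: "(nat \<Rightarrow> nat) \<Rightarrow> nat" assume "c \<in> decision_tree_classifiers d (2 ^ s)"
  then obtain t where t: "c = tree_eval t" "queries t \<subseteq> {1..d}" "labels t \<subseteq> {0, 1}"
    "num_leaves t \<le> 2 ^ s"
    by (auto simp: decision_tree_classifiers_def)
  have "real (num_leaves t) \<le> 2 ^ s"
    using t(4) by (metis of_nat_le_iff of_nat_numeral of_nat_power)
  moreover have "card (insert d {1..s}) = Suc s" using s by simp
  \<comment> \<open>With \<open>s + 1\<close> relevant bits, twice the error count is at least
    \<open>2 ^ (s + 1) - 2 ^ s = 2 ^ s\<close>, so at least a quarter of the
    \<open>2 ^ (s + 1)\<close> points are wrong.\<close>
  ultimately have "2 ^ s
      \<le> 2 * (\<Sum>A\<in>Pow (insert d {1..s}). absolute_loss (card A mod 2) (c (indicator_point d A)))"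
    using tree_parity_error[OF _ t(3,2), of "insert d {1..s}"] unfolding t(1)
    by (simp del: of_nat_le_numeral_power_cancel_iff)
  then show "1 / 4 * 2 ^ Suc (card {1..s})
      \<le> (\<Sum>A\<in>Pow (insert d {1..s}). absolute_loss (card A mod 2) (c (indicator_point d A)))"
    by simp
qed (use s in \<open>auto simp: absolute_loss_def\<close>)

theorem theorem1:
  fixes d s :: nat
  shows "(d \<ge> 2 \<longrightarrow>
            cost_of_coupling (cube d) {0, 1} 2 (last_bit_group d)
              (linear_regressors d) squared_loss \<ge> 1 / 4) \<and>
         (d \<ge> 2 \<longrightarrow>
            cost_of_coupling (cube d) {0, 1} 2 (last_bit_group d)
              (linear_separators d) absolute_loss \<ge> 1 / 4) \<and>
         (s < d \<longrightarrow>
            cost_of_coupling (cube d) {0, 1} 2 (last_bit_group d)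
              (decision_tree_classifiers d (2 ^ s)) absolute_loss \<ge> 1 / 4)"
  using cost_of_coupling_linear_regressors cost_of_coupling_linear_separators
    cost_of_coupling_decision_trees by blast

end
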